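(* For every $n\ge 1$, $$R_n(x)=\varphi(n)\Big(1-x^n+\sum_{d\mid n}\frac{\mu(d)}{\varphi(d)}\Psi_d\big(x^{n/d}\big)\Big),$$ where $R_n(x)=\sum_{k=0}^{n-1} c_n(k)x^k$ and $\Psi_d(x)=\sum_{1\le j\le d,\ \gcd(j,d)=1}x^j$.
   Context: For integers $n\ge 1$ and $k$, the Ramanujan sum $c_n(k)$ is the sum of the $k$th powers of the primitive $n$th roots of unity, i.e. $c_n(k)=\sum_{1\le j\le n,\ \gcd(j,n)=1} e^{2\pi \sqrt{-1}\, jk/n}$. $\varphi$ is Euler's function and $\mu$ the Möbius function. *)

theory Defs
  imports
    Complex_Main
    "HOL-Computational_Algebra.Computational_Algebra"
    "HOL-Number_Theory.Totient"
begin

definition ramanujan_sum :: "nat \<Rightarrow> int \<Rightarrow> complex" where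
  "ramanujan_sum n k =
     (\<Sum>j | 1 \<le> j \<and> j \<le> n \<and> gcd j n = 1.
        exp (2 * of_real pi * \<i> * of_nat j * of_int k / of_nat n))"

definition moebius_mu :: "nat \<Rightarrow> int" where
  "moebius_mu n = (if squarefree n then (- 1) ^ card (prime_factors n) else 0)"

definition ramanujan_poly :: "nat \<Rightarrow> complex poly" where
  "ramanujan_poly n = (\<Sum>k<n. monom (ramanujan_sum n (int k)) k)"

definition coprime_power_poly :: "nat \<Rightarrow> complex poly" where
  "coprime_power_poly d = (\<Sum>j | 1 \<le> j \<and> j \<le> d \<and> gcd j d = 1. monom 1 j)"

end

theory Submission
  imports Defs
begin

text \<open>
  Comparing coefficients reduces the identity to Hoelder's formula
  c_n(k) = phi(n) mu(d) / phi(d) with d = n / gcd(k, n), because every k in {1..n} is uniquely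
  (n / d) j with d dividing n and j in {1..d} coprime to d.
  The k-th powers of the primitive n-th roots of unity are powers w^j of a primitive d-th root w.
  Averaging the sum of w^j over multiplications of j by lifts of the units modulo d gives
  phi(d) c_n(k) = phi(n) c_d(1). For a prime p dividing n = p m, translating j by m shows that the
  sum of z^j over j coprime to m vanishes when z is a primitive n-th root of unity; this yields
  c_n(1) = 0 if p divides m and c_n(1) = - c_m(1) otherwise, hence c_n(1) = mu(n).
\<close>

section \<open>Power sums over the units modulo n\<close>

text \<open>Indices are the residues \<open>j < n\<close>, so that multiplication
  \<open>mod n\<close> acts on them. For \<open>n = 1\<close> the only index is 0, whereas
  \<open>ramanujan_sum\<close> uses 1.\<close>

definition unit_power_sum :: "nat \<Rightarrow> complex \<Rightarrow> complex" where
  "unit_power_sum n z = (\<Sum>j | j < n \<and> coprime j n. z ^ j)"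

lemma power_mod_period:
  fixes z :: "'a :: monoid_mult"
  assumes "z ^ n = 1"
  shows "z ^ (j mod n) = z ^ j"
proof -
  have "z ^ j = z ^ (n * (j div n) + j mod n)" by simp
  also have "\<dots> = z ^ (j mod n)"
    unfolding power_add power_mult assms by simp
  finally show ?thesis ..
qed

text \<open>Multiplication by \<open>u\<close> permutes the residues coprime to \<open>n\<close>,
  and \<open>z ^ j\<close> depends only on \<open>j mod n\<close>.\<close>

lemma unit_power_sum_power:
  assumes "n > 0" "z ^ n = 1" "coprime u n"
  shows "unit_power_sum n (z ^ u) = unit_power_sum n z"
proof -
  let ?T = "{j. j < n \<and> coprime j n}"
  let ?f = "\<lambda>j. u * j mod n"
  have inj: "inj_on ?f ?T"
  proof (rule inj_onI)
    fix x y assume xy: "x \<in> ?T" "y \<in> ?T" "u * x mod n = u * y mod n"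
    then have "[x = y] (mod n)"
      using assms(3) cong_mult_lcancel_nat[of u n x y] by (simp add: cong_def)
    then show "x = y" using xy by (simp add: cong_def)
  qed
  have "?f ` ?T \<subseteq> ?T"
    using assms by auto
  then have img: "?f ` ?T = ?T"
    by (intro endo_inj_surj inj) auto
  have "unit_power_sum n z = (\<Sum>j\<in>?f ` ?T. z ^ j)"
    unfolding unit_power_sum_def img ..
  also have "\<dots> = (\<Sum>j\<in>?T. z ^ ?f j)"
    by (subst sum.reindex[OF inj]) simp
  also have "\<dots> = unit_power_sum n (z ^ u)"
    unfolding unit_power_sum_def power_mod_period[OF assms(2)] by (simp add: power_mult)
  finally show ?thesis ..
qed

text \<open>Reduction from the units modulo \<open>n\<close> to the units modulo \<open>d\<close> is
  surjective; this lets factors modulo \<open>d\<close> act on sums over the units modulo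
  \<open>n\<close>.\<close>

lemma coprime_lift:
  fixes a d n :: nat
  assumes "n > 0" "d dvd n" "coprime a d"
  obtains u where "coprime u n" "[u = a] (mod d)"
proof
  \<comment> \<open>Every prime \<open>p\<close> of \<open>n\<close> divides exactly one of
    \<open>a\<close> and \<open>d * \<Prod>P\<close>: if \<open>p dvd a\<close>, then
    \<open>p\<close> divides neither \<open>d\<close> nor any element of \<open>P\<close>; otherwise
    \<open>p\<close> is in \<open>P\<close>. Hence no such \<open>p\<close> divides the sum
    \<open>u\<close>.\<close>
  define P where "P = {p \<in> prime_factors n. \<not> p dvd a}"
  define u where "u = a + d * \<Prod>P"
  have fin: "finite P" unfolding P_def by auto
  show "[u = a] (mod d)" unfolding u_def by (simp add: cong_def)
  show "coprime u n"
  proof (rule ccontr)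
    assume "\<not> coprime u n"
    then obtain p where p: "prime p" "p dvd u" "p dvd n"
      using prime_factor_nat[of "gcd u n"] by (auto simp: coprime_iff_gcd_eq_1)
    show False
    proof (cases "p dvd a")
      case True
      then have "p dvd d * \<Prod>P"
        using p(2) by (simp add: u_def dvd_add_right_iff)
      moreover have "\<not> p dvd d"
        using True p(1) assms(3) by (metis coprime_common_divisor not_prime_unit)
      ultimately have "p dvd \<Prod>P" using p(1) by (simp add: prime_dvd_mult_iff)
      then obtain q where q: "q \<in> P" "p dvd q"
        using p(1) fin by (auto simp: prime_dvd_prod_iff)
      then have "p = q"
        using p(1) by (auto simp: P_def intro: primes_dvd_imp_eq)
      then show False using True q(1) by (simp add: P_def)
    next
      case False
      then have "p \<in> P" using p assms(1) by (simp add: P_def prime_factors_dvd)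
      then have "p dvd d * \<Prod>P" using dvd_prodI[OF fin, of p "\<lambda>q. q"] by simp
      then have "p dvd a" using p(2) by (simp add: u_def dvd_add_left_iff)
      then show False using False by contradiction
    qed
  qed
qed

text \<open>The ranges 1..n and 0..n-1 differ only in 0 and \<open>n\<close>, which are coprime to
  \<open>n\<close> only if \<open>n = 1\<close>.\<close>

lemma totatives_eq_less:
  assumes "n > 0" "n \<noteq> 1"
  shows "totatives n = {j. j < n \<and> coprime j n}"
  using assms by (auto simp: totatives_def order_le_less intro!: Nat.gr0I)

lemma card_units_less_eq_totient:
  assumes "n > 0"
  shows "card {j. j < n \<and> coprime j n} = totient n"
proof (cases "n = 1")
  case True
  then have "{j. j < n \<and> coprime j n} = {0}" by auto
  then show ?thesis using True by simp
next
  case False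
  then show ?thesis using assms by (simp add: totient_def totatives_eq_less)
qed

text \<open>Double counting of \<open>w ^ (a * j)\<close> over units \<open>a\<close> modulo
  \<open>d\<close> and \<open>j\<close> modulo \<open>n\<close>. For fixed \<open>a\<close>, a lift
  of \<open>a\<close> to a unit modulo \<open>n\<close> permutes the \<open>j\<close>; for fixed
  \<open>j\<close>, the number \<open>j\<close> is itself a unit modulo \<open>d\<close> and
  permutes the \<open>a\<close>.\<close>

lemma unit_power_sum_reduce:
  assumes "n > 0" "d dvd n" "w ^ d = 1"
  shows "of_nat (totient d) * unit_power_sum n w = of_nat (totient n) * unit_power_sum d w"
proof -
  let ?T = "\<lambda>m::nat. {j. j < m \<and> coprime j m}"
  have d: "d > 0" using assms by (auto intro: Nat.gr0I)
  have wn: "w ^ n = 1" using assms(2,3) by (auto simp: power_mult elim!: dvdE)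
  have cong: "w ^ x = w ^ y" if "[x = y] (mod d)" for x y
    using that power_mod_period[OF assms(3)] by (metis cong_def)
  have "(\<Sum>j\<in>?T n. w ^ (a * j)) = unit_power_sum n w" if "a \<in> ?T d" for a
  proof -
    have "coprime a d" using that by simp
    then obtain u where u: "coprime u n" "[u = a] (mod d)"
      by (rule coprime_lift[OF assms(1,2)])
    have "w ^ a = w ^ u" using cong[OF u(2)] ..
    then have "(\<Sum>j\<in>?T n. w ^ (a * j)) = unit_power_sum n (w ^ u)"
      by (simp add: unit_power_sum_def power_mult)
    then show ?thesis using unit_power_sum_power[OF assms(1) wn u(1)] by simp
  qed
  then have "of_nat (totient d) * unit_power_sum n w = (\<Sum>a\<in>?T d. \<Sum>j\<in>?T n. w ^ (a * j))"
    using card_units_less_eq_totient[OF d] by simp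
  also have "\<dots> = (\<Sum>j\<in>?T n. \<Sum>a\<in>?T d. w ^ (a * j))"
    by (rule sum.swap)
  also have "\<dots> = (\<Sum>j\<in>?T n. unit_power_sum d w)"
  proof (intro sum.cong refl)
    fix j assume j: "j \<in> ?T n"
    then have "coprime j d" using coprime_divisors[OF dvd_refl assms(2)] by simp
    then have "unit_power_sum d (w ^ j) = unit_power_sum d w"
      using unit_power_sum_power[OF d assms(3)] by blast
    then show "(\<Sum>a\<in>?T d. w ^ (a * j)) = unit_power_sum d w"
      by (simp add: unit_power_sum_def power_mult[symmetric] mult.commute)
  qed
  also have "\<dots> = of_nat (totient n) * unit_power_sum d w"
    using card_units_less_eq_totient[OF assms(1)] by simp
  finally show ?thesis .
qed

section \<open>Evaluation at a primitive root of unity\<close>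

text \<open>Each unit shift trades the term \<open>f m\<close> for \<open>f (n + m)\<close>, which
  is equal by periodicity.\<close>

lemma sum_shift_periodic:
  fixes f :: "nat \<Rightarrow> 'a :: ab_group_add"
  assumes "\<And>j. f (j + n) = f j"
  shows "(\<Sum>j<n. f (j + m)) = (\<Sum>j<n. f j)"
proof (induction m)
  case (Suc m)
  have "f m + (\<Sum>j<n. f (j + Suc m)) = (\<Sum>j<n. f (j + m)) + f (n + m)"
    using sum.lessThan_Suc_shift[of "\<lambda>j. f (j + m)" n] by simp
  then show ?case using Suc.IH assms[of m] by (simp add: add.commute)
qed simp

text \<open>A repeated prime destroys squarefreeness and a new prime flips the sign. The power sums
  at primitive roots obey the same recursion.\<close>

lemma moebius_mu_prime_mult:
  assumes "prime p" "m > 0"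
  shows "moebius_mu (p * m) = (if p dvd m then 0 else - moebius_mu m)"
proof (cases "p dvd m")
  case True
  then have "p\<^sup>2 dvd p * m" by (simp add: power2_eq_square)
  then have "\<not> squarefree (p * m)"
    using assms(1) by (auto simp: squarefree_def dest!: spec[of _ p])
  then show ?thesis using True by (simp add: moebius_mu_def)
next
  case False
  then have cop: "coprime p m" using assms(1) by (simp add: prime_imp_coprime)
  have "squarefree (p * m) \<longleftrightarrow> squarefree m"
    using cop assms(1) by (auto simp: squarefree_mult_coprime squarefree_prime
        intro: squarefree_multD)
  moreover have "prime_factors (p * m) = insert p (prime_factors m)"
    using assms by (subst prime_factors_product) (auto simp: prime_factorization_prime)
  moreover have "p \<notin> prime_factors m" using False by auto
  ultimately show ?thesis using False by (simp add: moebius_mu_def)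
qed

text \<open>The induction strips one prime \<open>p\<close> from \<open>n = p * m\<close>. It keeps
  \<open>z\<close> arbitrary because it passes from \<open>z\<close> to \<open>z ^ p\<close>, a
  primitive \<open>m\<close>-th root of unity.\<close>

lemma unit_power_sum_primitive_root:
  assumes "n > 0" "\<And>m. z ^ m = 1 \<longleftrightarrow> n dvd m"
  shows "unit_power_sum n z = of_int (moebius_mu n)"
  using assms
proof (induction n arbitrary: z rule: less_induct)
  case (less n)
  show ?case
  proof (cases "n = 1")
    case True
    then have "{j. j < n \<and> coprime j n} = {0}" by auto
    then show ?thesis using True by (simp add: unit_power_sum_def moebius_mu_def)
  next
    case False
    then obtain p where p: "prime p" "p dvd n" using prime_factor_nat by blast
    then obtain m where n: "n = p * m" by (elim dvdE)
    have m: "m > 0" "m < n" using less.prems(1) p(1) prime_gt_1_nat[of p] by (auto simp: n)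
    \<comment> \<open>Extension by zero makes \<open>f\<close> periodic modulo \<open>n\<close>,
      while translation by \<open>m\<close> multiplies it by \<open>z ^ m\<close>. Since
      \<open>z ^ m\<close> is not 1 for \<open>0 < m < n\<close>, the sum over a full period must
      vanish.\<close>
    define f where "f j = (if coprime j m then z ^ j else 0)" for j
    have zn: "z ^ n = 1" using less.prems(2) by simp
    have "coprime (j + m) m \<longleftrightarrow> coprime j m" for j
      by (simp add: coprime_iff_gcd_eq_1)
    then have shift: "f (j + m) = z ^ m * f j" for j
      by (simp add: f_def power_add)
    have "coprime (j + n) m \<longleftrightarrow> coprime j m" for j
      using gcd_add_mult[of m p j] by (simp add: n coprime_iff_gcd_eq_1 gcd.commute add.commute)
    then have "f (j + n) = f j" for j
      by (simp add: f_def power_add zn)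
    from sum_shift_periodic[of f, OF this, of m]
    have "z ^ m * (\<Sum>j<n. f j) = (\<Sum>j<n. f j)"
      by (simp add: shift sum_distrib_left)
    moreover have "z ^ m \<noteq> 1" using less.prems(2) m by (auto dest: dvd_imp_le)
    ultimately have "(\<Sum>j<n. f j) = 0" by simp
    then have zero: "(\<Sum>j | j < n \<and> coprime j m. z ^ j) = 0"
      by (simp add: f_def sum.If_cases Int_def)
    show ?thesis
    proof (cases "p dvd m")
      case True
      \<comment> \<open>Here \<open>n\<close> and \<open>m\<close> have the same prime divisors, so
        the vanishing sum is already \<open>unit_power_sum n z\<close>.\<close>
      then have "coprime j n \<longleftrightarrow> coprime j m" for j
        using coprime_divisors[OF dvd_refl True, of j] by (auto simp: n)
      then show ?thesis
        using zero True moebius_mu_prime_mult[OF p(1) m(1)] by (simp add: unit_power_sum_def n)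
    next
      case False
      let ?A = "{j. j < n \<and> coprime j n}" and ?B = "{j. j < m \<and> coprime j m}"
      have pm: "coprime p m" using False p(1) by (simp add: prime_imp_coprime)
      have p0: "p > 0" using p(1) by (simp add: prime_gt_0_nat)
      have cop: "coprime j p \<longleftrightarrow> \<not> p dvd j" for j
        using p(1) by (metis coprime_commute prime_imp_coprime coprime_absorb_left not_prime_unit)
      \<comment> \<open>A residue coprime to \<open>m\<close> is either coprime to \<open>p\<close>,
        hence to \<open>n\<close>, or \<open>p\<close> times a unit modulo \<open>m\<close>. The
        second kind contributes the power sum of \<open>z ^ p\<close> modulo
        \<open>m\<close>.\<close>
      have split: "{j. j < n \<and> coprime j m} = ?A \<union> (*) p ` ?B"
      proof (intro equalityI subsetI)
        fix j assume j: "j \<in> {j. j < n \<and> coprime j m}"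
        show "j \<in> ?A \<union> (*) p ` ?B"
        proof (cases "p dvd j")
          case True
          then obtain i where "j = p * i" by (elim dvdE)
          then show ?thesis using j p0 by (auto simp: n)
        next
          case False
          then show ?thesis using j by (auto simp: n cop)
        qed
      qed (use p0 pm in \<open>auto simp: n\<close>)
      have "(\<Sum>j | j < n \<and> coprime j m. z ^ j) = (\<Sum>j\<in>?A. z ^ j) + (\<Sum>j\<in>(*) p ` ?B. z ^ j)"
        unfolding split by (rule sum.union_disjoint) (auto simp: n cop)
      also have "(\<Sum>j\<in>(*) p ` ?B. z ^ j) = unit_power_sum m (z ^ p)"
        using p0 by (subst sum.reindex) (auto simp: unit_power_sum_def power_mult inj_on_def)
      also have "\<dots> = of_int (moebius_mu m)"
      proof (rule less.IH[OF m(2,1)])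
        show "(z ^ p) ^ k = 1 \<longleftrightarrow> m dvd k" for k
          using less.prems(2)[of "p * k"] p0 by (simp add: power_mult n)
      qed
      finally show ?thesis
        using zero False moebius_mu_prime_mult[OF p(1) m(1)]
        by (simp add: unit_power_sum_def n add_eq_0_iff2)
    qed
  qed
qed

section \<open>Ramanujan sums and Hoelder's formula\<close>

lemma cis_eq_1_iff_int: "cis (2 * pi * x) = 1 \<longleftrightarrow> x \<in> \<int>"
proof -
  have "cis (2 * pi * x) = 1 \<longleftrightarrow> cos (2 * pi * x) = 1"
    by (auto simp: complex_eq_iff cos_one_sin_zero)
  also have "\<dots> \<longleftrightarrow> x \<in> \<int>"
    by (auto simp: cos_one_2pi_int elim!: Ints_cases)
  finally show ?thesis .
qed

lemma cis_primitive_root: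
  assumes "d > 0" "coprime k d"
  shows "cis (2 * pi * (real k / real d)) ^ m = 1 \<longleftrightarrow> d dvd m"
proof -
  have "cis (2 * pi * (real k / real d)) ^ m = cis (2 * pi * (real (m * k) / real d))"
    unfolding DeMoivre by (simp add: mult_ac)
  also have "\<dots> = 1 \<longleftrightarrow> real (m * k) / real d \<in> \<int>"
    by (rule cis_eq_1_iff_int)
  also have "\<dots> \<longleftrightarrow> d dvd m * k"
  proof
    assume "real (m * k) / real d \<in> \<int>"
    then obtain i where "real (m * k) / real d = of_int i" by (elim Ints_cases)
    then have "of_int (int (m * k)) = (of_int (int d * i) :: real)"
      using assms(1) by (simp add: field_simps)
    then have "int (m * k) = int d * i" by (simp only: of_int_eq_iff)
    then have "int d dvd int (m * k)" by (rule dvdI)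
    then show "d dvd m * k" by (simp only: int_dvd_int_iff)
  next
    assume "d dvd m * k"
    then obtain i where "m * k = d * i" by (elim dvdE)
    then have "real (m * k) / real d = real i" using assms(1) by simp
    then show "real (m * k) / real d \<in> \<int>" by simp
  qed
  also have "\<dots> \<longleftrightarrow> d dvd m"
    using assms(2) by (simp add: coprime_dvd_mult_left_iff coprime_commute)
  finally show ?thesis .
qed

lemma ramanujan_sum_eq_unit_power_sum:
  assumes "n > 0"
  shows "ramanujan_sum n (int k) = unit_power_sum n (cis (2 * pi * (real k / real n)))"
proof -
  let ?z = "cis (2 * pi * (real k / real n))"
  have z: "exp (2 * of_real pi * \<i> * of_nat j * of_int (int k) / of_nat n) = ?z ^ j" for j
    unfolding DeMoivre unfolding cis_conv_exp by (simp add: mult_ac)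
  have "{j. 1 \<le> j \<and> j \<le> n \<and> gcd j n = 1} = {j. j < n \<and> coprime j n}" if "n \<noteq> 1"
    using totatives_eq_less[OF assms that]
    by (auto simp: totatives_def coprime_iff_gcd_eq_1 Suc_le_eq)
  \<comment> \<open>For \<open>n = 1\<close> the index sets really differ, but the base
    \<open>?z\<close> is then 1, so the sums still agree.\<close>
  moreover have "{j. 1 \<le> j \<and> j \<le> n \<and> gcd j n = 1} = {1}"
    "{j. j < n \<and> coprime j n} = {0}" if "n = 1"
    using that by auto
  moreover have "?z = 1" if "n = 1"
    using that cis_eq_1_iff_int[of "real k"] by simp
  ultimately show ?thesis
    unfolding ramanujan_sum_def unit_power_sum_def z by (cases "n = 1") auto
qed

text \<open>In lowest terms \<open>k / n\<close> is \<open>l / d\<close>, so the base is a primitive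
  \<open>d\<close>-th root of unity. Passing from \<open>n\<close> to \<open>d\<close> costs the
  ratio of the totients, and the remaining sum is the Moebius value at \<open>d\<close>.\<close>

lemma ramanujan_sum_hoelder:
  assumes "n > 0"
  shows "ramanujan_sum n (int k) = of_nat (totient n) *
    (of_int (moebius_mu (n div gcd k n)) / of_nat (totient (n div gcd k n)))"
proof -
  define g d l where "g = gcd k n" and "d = n div g" and "l = k div g"
  have g: "g > 0" "g * d = n" "g * l = k"
    using assms by (auto simp: g_def d_def l_def)
  then have d: "d > 0" "d dvd n" using assms by (auto intro: Nat.gr0I)
  have cop: "coprime l d"
    using assms unfolding l_def d_def g_def by (intro div_gcd_coprime) auto
  let ?w = "cis (2 * pi * (real l / real d))"
  have "real k / real n = real l / real d"
    using g(1) d(1) by (simp flip: g(2,3))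
  then have "ramanujan_sum n (int k) = unit_power_sum n ?w"
    using ramanujan_sum_eq_unit_power_sum[OF assms, of k] by simp
  moreover have "of_nat (totient d) * unit_power_sum n ?w =
      of_nat (totient n) * unit_power_sum d ?w"
    using cis_primitive_root[OF d(1) cop] by (intro unit_power_sum_reduce assms d) simp
  moreover have "unit_power_sum d ?w = of_int (moebius_mu d)"
    using cis_primitive_root[OF d(1) cop] by (intro unit_power_sum_primitive_root d)
  moreover have "totient d > 0" using d by simp
  ultimately show ?thesis
    by (simp add: field_simps flip: d_def g_def)
qed

section \<open>Regrouping exponents by divisors and comparing coefficients\<close>

lemma smult_sum_right: "smult c (\<Sum>i\<in>S. f i) = (\<Sum>i\<in>S. smult c (f i))"
  by (induction S rule: infinite_finite_induct) (simp_all add: smult_add_right)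

lemma pcompose_coprime_power_poly:
  "pcompose (coprime_power_poly d) (monom 1 e) =
    (\<Sum>j | 1 \<le> j \<and> j \<le> d \<and> gcd j d = 1. monom 1 (e * j))"
proof -
  have mon: "pcompose (monom 1 j) q = q ^ j" for j and q :: "complex poly"
    by (induction j) (simp_all add: monom_Suc pcompose_pCons pcompose_1)
  show ?thesis
    unfolding coprime_power_poly_def pcompose_sum mon by (simp add: monom_power)
qed

text \<open>The fractions \<open>k / n\<close> are sorted by their reduced form
  \<open>j / d\<close>. The function \<open>f\<close> takes both the denominator and the exponent,
  so that weights depending on \<open>d\<close> survive the reindexing.\<close>

lemma sum_divisors_totatives:
  fixes f :: "nat \<Rightarrow> nat \<Rightarrow> 'a :: comm_monoid_add"
  assumes "n > 0"
  shows "(\<Sum>d | d dvd n. \<Sum>j | 1 \<le> j \<and> j \<le> d \<and> gcd j d = 1. f d (n div d * j)) =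
    (\<Sum>k\<in>{1..n}. f (n div gcd k n) k)"
proof -
  have "(\<Sum>d | d dvd n. \<Sum>j | 1 \<le> j \<and> j \<le> d \<and> gcd j d = 1. f d (n div d * j)) =
    (\<Sum>(d, j)\<in>(SIGMA d:{d. d dvd n}. {j. 1 \<le> j \<and> j \<le> d \<and> gcd j d = 1}). f d (n div d * j))"
    using assms by (intro sum.Sigma) auto
  also have "\<dots> = (\<Sum>k\<in>{1..n}. f (n div gcd k n) k)"
  proof (rule sum.reindex_bij_witness[where
        j = "\<lambda>(d, j). n div d * j" and i = "\<lambda>k. (n div gcd k n, k div gcd k n)"], goal_cases)
    case (1 x)
    then obtain d j where x: "x = (d, j)" "d dvd n" "gcd j d = 1" by auto
    then obtain e where e: "n = d * e" by (elim dvdE)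
    then have "gcd (e * j) (e * d) = e"
      using x(3) by (simp add: gcd_mult_distrib_nat[symmetric])
    then show ?case using e x assms by (simp add: mult.commute)
  next
    case (2 x)
    then obtain d j where x: "x = (d, j)" "d dvd n" "gcd j d = 1" "1 \<le> j" "j \<le> d" by auto
    then obtain e where e: "n = d * e" by (elim dvdE)
    then show ?case using x assms by auto
  next
    case (3 k)
    have "n div (n div g) = g" if "g dvd n" for g
      using that assms by (auto elim!: dvdE)
    then have "n div (n div gcd k n) = gcd k n" by simp
    then show ?case by simp
  next
    case (4 k)
    have "coprime (k div gcd k n) (n div gcd k n)"
      using assms by (intro div_gcd_coprime) auto
    moreover have "k div gcd k n > 0"
      using 4 by (simp add: div_greater_zero_iff)
    moreover have "k div gcd k n \<le> n div gcd k n"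
      using 4 by (intro div_le_mono) simp
    moreover have "n div gcd k n dvd n"
      by (intro div_dvd_iff_mult[THEN iffD2]) (use assms in auto)
    ultimately show ?case
      unfolding mem_Sigma_iff mem_Collect_eq coprime_iff_gcd_eq_1 by linarith
  next
    case (5 x)
    then obtain d j where x: "x = (d, j)" "d dvd n" "gcd j d = 1" by auto
    then obtain e where e: "n = d * e" by (elim dvdE)
    then have "gcd (e * j) (e * d) = e"
      using x(3) by (simp add: gcd_mult_distrib_nat[symmetric])
    then show ?case using e x assms by (simp add: mult.commute)
  qed
  finally show ?thesis .
qed

theorem theorem9:
  fixes n :: nat
  assumes "n \<ge> 1"
  shows "ramanujan_poly n =
    smult (of_nat (totient n))
      (1 - monom 1 n +
        (\<Sum>d | d dvd n.
           smult (of_int (moebius_mu d) / of_nat (totient d))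
             (pcompose (coprime_power_poly d) (monom 1 (n div d)))))"
proof -
  have n: "n > 0" using assms by simp
  define a :: "nat \<Rightarrow> complex" where "a d = of_int (moebius_mu d) / of_nat (totient d)" for d
  define b where "b k = monom (a (n div gcd k n)) k" for k
  have a1: "a 1 = 1" by (simp add: a_def moebius_mu_def)
  \<comment> \<open>Both \<open>gcd 0 n\<close> and \<open>gcd n n\<close> equal \<open>n\<close>,
    so both end coefficients are \<open>a 1 = 1\<close>. The divisor sum covers the exponents 1..n,
    and adding \<open>1 - monom 1 n\<close> trades \<open>n\<close> for 0, as
    \<open>ramanujan_poly\<close> requires.\<close>
  then have b0: "b 0 = 1" and bn: "b n = monom 1 n"
    using n by (simp_all add: b_def)
  have "(\<Sum>d | d dvd n. smult (a d) (pcompose (coprime_power_poly d) (monom 1 (n div d)))) =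
    (\<Sum>d | d dvd n. \<Sum>j | 1 \<le> j \<and> j \<le> d \<and> gcd j d = 1. monom (a d) (n div d * j))"
    by (simp add: pcompose_coprime_power_poly smult_sum_right smult_monom)
  also have "\<dots> = (\<Sum>k\<in>{1..n}. b k)"
    unfolding b_def by (rule sum_divisors_totatives[OF n])
  also have "\<dots> = (\<Sum>k<n. b (Suc k))"
    by (simp add: sum.atLeast1_atMost_eq)
  finally have "1 - monom 1 n +
      (\<Sum>d | d dvd n. smult (a d) (pcompose (coprime_power_poly d) (monom 1 (n div d)))) =
      (\<Sum>k<n. b k)"
    using sum.lessThan_Suc_shift[of b n] by (simp add: b0 bn algebra_simps)
  then show ?thesis
    by (simp add: a_def b_def ramanujan_poly_def ramanujan_sum_hoelder[OF n]
        smult_sum_right smult_monom)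
qed

end
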